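(* Let $1\le \underline{k}\le \overline{k}$ be integers. Then, as formal Laurent series in $x$ with coefficients in $\mathbb{Z}[y]$, $$S_{\underline{k}\le\overline{k}}(x,y)=2x\,W_{(\underline{k}-1)\le(\overline{k}-1)}(x,y).$$
   Context: An $n$-string is a binary string of length $n$. A run of a bit $b$ in an $n$-string is a maximal block of consecutive $b$'s, flanked on each side by the opposite bit or by the start/end of the string; its length is the number of its bits. Null runs (length $0$) of ones also count: there is one between every two consecutive zeros, one before an initial zero and one after a final zero. Thus a string with $z$ zeros has exactly $z+1$ runs of ones (including null ones), namely the possibly empty blocks of ones delimited by the zeros; the empty string has one null run of ones. For $0\le a\le b$, $w_{a\le b}(n,m)$ is, for $n\ge 0$, the number of $n$-strings containing exactly $m$ runs of ones whose length lies in $[a,b]$ (null runs included if $a=0$; other runs are unrestricted). By convention $w_{a\le b}(-1,m)=1$ if $m=0$ and $0$ otherwise, and $w_{a\le b}(n,m)=0$ for $n<-1$ or $m<0$. Set $W_{a\le b}(x,y)=\sum_{n,m} w_{a\le b}(n,m)x^ny^m$, summing over all integers $n,m$. For $1\le a\le b$, $s_{a\le b}(n,m)$ is, for $n\ge 1$, the number of $n$-strings in which the total number of runs of ones and runs of zeros (all nonnull) whose length lies in $[a,b]$ is exactly $m$. By convention $s_{a\le b}(0,m)=2$ if $m=0$ and $0$ otherwise, and $s_{a\le b}(n,m)=0$ for $n<0$ or $m<0$. Set $S_{a\le b}(x,y)=\sum_{n,m}s_{a\le b}(n,m)x^ny^m$. *)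

theory Defs
  imports "HOL-Computational_Algebra.Formal_Laurent_Series"
begin

text \<open>
  Binary strings are lists of booleans; \<open>True\<close> is the bit 1 and \<open>False\<close> is the bit 0.
\<close>

definition strings :: "nat \<Rightarrow> bool list set" where
  "strings n = {xs. length xs = n}"

text \<open>
  A run of the bit \<open>c\<close> is given by its starting position \<open>i\<close> and its length \<open>l\<close>: all bits at the
  positions \<open>i, \<dots>, i + l - 1\<close> are \<open>c\<close>, and the block is flanked on each side by the opposite bit or
  by the start/end of the string. For \<open>l = 0\<close> and \<open>c = True\<close> these are exactly the null runs of
  ones: position \<open>i\<close> is then preceded by a zero or the start of the string, and followed by a zero
  or the end of the string; in particular \<open>(0, 0)\<close> is the only run of ones of the empty string.
\<close>

definition runs :: "bool \<Rightarrow> bool list \<Rightarrow> (nat \<times> nat) set" where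
  "runs c xs = {(i, l). i + l \<le> length xs
      \<and> (\<forall>j. i \<le> j \<and> j < i + l \<longrightarrow> xs ! j = c)
      \<and> (i = 0 \<or> xs ! (i - 1) \<noteq> c)
      \<and> (i + l = length xs \<or> xs ! (i + l) \<noteq> c)}"

definition num_runs :: "bool \<Rightarrow> nat \<Rightarrow> nat \<Rightarrow> bool list \<Rightarrow> nat" where
  "num_runs c a b xs = card {(i, l) \<in> runs c xs. a \<le> l \<and> l \<le> b}"

definition w_num :: "nat \<Rightarrow> nat \<Rightarrow> int \<Rightarrow> int \<Rightarrow> nat" where
  "w_num a b n m =
     (if n \<ge> 0 then card {xs \<in> strings (nat n). int (num_runs True a b xs) = m}
      else if n = -1 \<and> m = 0 then 1 else 0)"

text \<open>Only meant for \<open>a \<ge> 1\<close>, so that null runs are not counted.\<close>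

definition s_num :: "nat \<Rightarrow> nat \<Rightarrow> int \<Rightarrow> int \<Rightarrow> nat" where
  "s_num a b n m =
     (if n \<ge> 1 then
        card {xs \<in> strings (nat n). int (num_runs True a b xs + num_runs False a b xs) = m}
      else if n = 0 \<and> m = 0 then 2 else 0)"

text \<open>
  The generating functions are Laurent series in \<open>x\<close> (\<open>fls_X\<close>) over the polynomials in \<open>y\<close>. Both are
  well-defined, see \<open>coeff_W_series\<close> and \<open>coeff_S_series\<close> below. The numbers \<open>w_num a b n m\<close> and
  \<open>s_num a b n m\<close> vanish for \<open>m < 0\<close>, so no terms are lost by letting \<open>m\<close> range over the naturals.
\<close>

definition W_series :: "nat \<Rightarrow> nat \<Rightarrow> int poly fls" where
  "W_series a b = Abs_fls (\<lambda>n. Abs_poly (\<lambda>m. int (w_num a b n (int m))))"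

definition S_series :: "nat \<Rightarrow> nat \<Rightarrow> int poly fls" where
  "S_series a b = Abs_fls (\<lambda>n. Abs_poly (\<lambda>m. int (s_num a b n (int m))))"

lemma w_num_neg: "m < 0 \<Longrightarrow> w_num a b n m = 0"
  by (auto simp: w_num_def)

lemma s_num_neg: "m < 0 \<Longrightarrow> s_num a b n m = 0"
  by (auto simp: s_num_def)

lemma finite_strings: "finite (strings n)"
  using finite_lists_length_eq[of "UNIV :: bool set" n] by (simp add: strings_def)

lemma eventually_no_string:
  fixes f :: "bool list \<Rightarrow> nat"
  shows "\<forall>\<^sub>\<infinity>m. card {xs \<in> strings n. f xs = m} = 0"
proof -
  have "{m. card {xs \<in> strings n. f xs = m} \<noteq> 0} \<subseteq> f ` strings n"
    by (auto simp: card_eq_0_iff)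
  then have "finite {m. card {xs \<in> strings n. f xs = m} \<noteq> 0}"
    using finite_strings finite_surj by blast
  then show ?thesis
    by (simp add: eventually_cofinite)
qed

lemma eventually_zero_if_0: "\<forall>\<^sub>\<infinity>m. (if P \<and> m = (0::nat) then c else 0) = (0::nat)"
  by (auto simp: MOST_nat intro: exI[of _ 0])

lemma eventually_w: "\<forall>\<^sub>\<infinity>m. int (w_num a b n (int m)) = 0"
proof (cases "n \<ge> 0")
  case True
  then show ?thesis
    using eventually_no_string[of "nat n" "num_runs True a b"] by (simp add: w_num_def)
next
  case False
  then show ?thesis
    using eventually_zero_if_0[of "n = -1" 1] by (simp add: w_num_def)
qed

lemma eventually_s: "\<forall>\<^sub>\<infinity>m. int (s_num a b n (int m)) = 0"
proof (cases "n \<ge> 1")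
  case True
  have eq: "(int x + int y = int m) = (x + y = m)" for x y m
    by linarith
  from True show ?thesis
    using eventually_no_string[of "nat n" "\<lambda>xs. num_runs True a b xs + num_runs False a b xs"]
    by (simp add: s_num_def eq)
next
  case False
  then show ?thesis
    using eventually_zero_if_0[of "n = 0" 2] by (simp add: s_num_def)
qed

lemma coeff_W_series: "coeff (fls_nth (W_series a b) n) m = int (w_num a b n (int m))"
proof -
  have "\<forall>\<^sub>\<infinity>k. Abs_poly (\<lambda>m. int (w_num a b (- int k) (int m))) = 0"
  proof (unfold MOST_nat, intro exI[of _ 1] allI impI)
    fix k :: nat assume "1 < k"
    then have "(\<lambda>m. int (w_num a b (- int k) (int m))) = (\<lambda>m. 0)"
      by (auto simp: w_num_def)
    then show "Abs_poly (\<lambda>m. int (w_num a b (- int k) (int m))) = 0"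
      by (simp add: zero_poly_def)
  qed
  then show ?thesis
    by (simp add: W_series_def Abs_fls_inverse Abs_poly_inverse[OF CollectI, OF eventually_w])
qed

lemma coeff_S_series: "coeff (fls_nth (S_series a b) n) m = int (s_num a b n (int m))"
proof -
  have "\<forall>\<^sub>\<infinity>k. Abs_poly (\<lambda>m. int (s_num a b (- int k) (int m))) = 0"
  proof (unfold MOST_nat, intro exI[of _ 1] allI impI)
    fix k :: nat assume "1 < k"
    then have "(\<lambda>m. int (s_num a b (- int k) (int m))) = (\<lambda>m. 0)"
      by (auto simp: s_num_def)
    then show "Abs_poly (\<lambda>m. int (s_num a b (- int k) (int m))) = 0"
      by (simp add: zero_poly_def)
  qed
  then show ?thesis
    by (simp add: S_series_def Abs_fls_inverse Abs_poly_inverse[OF CollectI, OF eventually_s])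
qed

end

theory Submission
  imports Defs
begin

text \<open>
  Record, for every two neighbouring bits of a nonempty string, whether they are equal: this turns
  a string of length \<open>n + 1\<close> into a string of length \<open>n\<close>, and the first bit together with this
  record determines the string. A run of length \<open>l \<ge> 1\<close>, of either bit, consists of \<open>l\<close> equal bits
  between two changes (or ends of the string), so it becomes a run of \<open>l - 1\<close> ones in the record,
  and every run of ones of the record, null runs included, arises in this way. Hence the strings of
  length \<open>n\<close> with \<open>m\<close> runs of ones of length in \<open>[k - 1, K - 1]\<close> correspond, one to two, to the
  strings of length \<open>n + 1\<close> with \<open>m\<close> runs of length in \<open>[k, K]\<close>. This gives
  \<open>s(n + 1, m) = 2 w(n, m)\<close> for \<open>n \<ge> 0\<close>; the conventions at \<open>s(0, m)\<close> and \<open>w(-1, m)\<close> extend it to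
  all integers \<open>n\<close>.

  The proof works with the inverse map \<open>decode\<close>: \<open>num_runs_decode\<close> compares the numbers of
  runs, and \<open>bij_betw_decode\<close> gives the factor 2 as the choice of the first bit.
\<close>

text \<open>
  In the recursive call, \<open>c = d\<close> is the next bit: it repeats \<open>c\<close> if \<open>d\<close> is 1 and is the opposite of
  \<open>c\<close> if \<open>d\<close> is 0.
\<close>

fun decode :: "bool \<Rightarrow> bool list \<Rightarrow> bool list" where
  "decode c [] = [c]"
| "decode c (d # ds) = c # decode (c = d) ds"

lemma length_decode [simp]: "length (decode c ds) = Suc (length ds)"
  by (induction ds arbitrary: c) auto

lemma decode_nth_0 [simp]: "decode c ds ! 0 = c"
  by (cases ds) auto

lemma decode_nth_Suc:
  "i < length ds \<Longrightarrow> decode c ds ! Suc i = (decode c ds ! i = ds ! i)"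
proof (induction ds arbitrary: c i)
  case (Cons d ds)
  then show ?case
    by (cases i) auto
qed simp

lemma decode_neq_Nil [simp]: "decode c ds \<noteq> []" "[] \<noteq> decode c ds"
  by (cases ds; simp)+

lemma decode_inject: "decode c ds = decode c' ds' \<longleftrightarrow> c = c' \<and> ds = ds'"
proof (induction ds arbitrary: c c' ds')
  case Nil
  show ?case
    by (cases ds') auto
next
  case (Cons d ds)
  then show ?case
    by (cases ds') auto
qed

lemma ex_decode: "xs \<noteq> [] \<Longrightarrow> \<exists>ds. xs = decode (hd xs) ds"
proof (induction xs rule: induct_list012)
  case (3 x y zs)
  then obtain ds where "y # zs = decode y ds"
    by auto
  then have "x # y # zs = decode x ((x = y) # ds)"
    by (cases x) auto
  then show ?case
    by (metis list.sel(1))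
qed (auto intro: exI[of _ "[]"])

lemma bij_betw_decode:
  "bij_betw (\<lambda>(c, ds). decode c ds) (UNIV \<times> strings n) (strings (Suc n))"
proof (rule bij_betw_imageI)
  show "inj_on (\<lambda>(c, ds). decode c ds) (UNIV \<times> strings n)"
    by (auto simp: inj_on_def decode_inject)
  show "(\<lambda>(c, ds). decode c ds) ` (UNIV \<times> strings n) = strings (Suc n)"
  proof (intro equalityI subsetI)
    fix xs assume "xs \<in> strings (Suc n)"
    then have len: "length xs = Suc n"
      by (simp add: strings_def)
    then have "xs \<noteq> []"
      by auto
    then obtain ds where ds: "xs = decode (hd xs) ds"
      using ex_decode by blast
    then have "length ds = n"
      using len length_decode[of "hd xs" ds] by simp
    with ds show "xs \<in> (\<lambda>(c, ds). decode c ds) ` (UNIV \<times> strings n)"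
      by (auto simp: strings_def image_iff)
  qed (auto simp: strings_def)
qed

text \<open>
  A block of \<open>l + 1\<close> bits has \<open>l\<close> pairs of neighbours; this is where the length of a run drops
  by one.
\<close>

lemma decode_constant_iff:
  assumes "i + l \<le> length ds"
  shows "(\<forall>j. i \<le> j \<and> j < i + Suc l \<longrightarrow> decode c ds ! j = decode c ds ! i)
    \<longleftrightarrow> (\<forall>j. i \<le> j \<and> j < i + l \<longrightarrow> ds ! j)"
  using assms
proof (induction l)
  case 0
  then show ?case
    using le_antisym by fastforce
next
  case (Suc l)
  have "decode c ds ! Suc (i + l) = (decode c ds ! (i + l) = ds ! (i + l))"
    using Suc.prems by (intro decode_nth_Suc) simp
  moreover have split: "(\<forall>j. i \<le> j \<and> j < i + Suc k \<longrightarrow> P j)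
      \<longleftrightarrow> (\<forall>j. i \<le> j \<and> j < i + k \<longrightarrow> P j) \<and> P (i + k)" for k and P :: "nat \<Rightarrow> bool"
    by (auto simp: less_Suc_eq)
  ultimately show ?case
    using Suc split[of "Suc l" "\<lambda>j. decode c ds ! j = decode c ds ! i"]
      split[of l "\<lambda>j. decode c ds ! j = decode c ds ! i"] split[of l "\<lambda>j. ds ! j"]
    by auto
qed

text \<open>
  The bit of a nonnull run is the bit at its starting position, so \<open>(i, Suc l)\<close> can be a run of
  one bit only, namely \<open>b = decode c ds ! i\<close>. Inside the string, a run ends where the neighbouring
  bit differs, that is, where the record \<open>ds\<close> has a 0.
\<close>

lemma runs_decode_iff:
  "(i, Suc l) \<in> runs b (decode c ds) \<longleftrightarrow> b = decode c ds ! i \<and> (i, l) \<in> runs True ds"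
proof (cases "i + l \<le> length ds \<and> b = decode c ds ! i")
  case True
  have left: "decode c ds ! (i - 1) \<noteq> b \<longleftrightarrow> \<not> ds ! (i - 1)" if "i \<noteq> 0"
  proof -
    have "i - 1 < length ds"
      using True that by linarith
    then show ?thesis
      using True decode_nth_Suc[of "i - 1" ds c] that by auto
  qed
  have right: "(\<not> ds ! (i + l)) \<longleftrightarrow> decode c ds ! Suc (i + l) \<noteq> b"
    if "i + l \<noteq> length ds" "decode c ds ! (i + l) = b"
    using True decode_nth_Suc[of "i + l" ds c] that by auto
  have const: "(\<forall>j. i \<le> j \<and> j < i + Suc l \<longrightarrow> decode c ds ! j = b)
      \<longleftrightarrow> (\<forall>j. i \<le> j \<and> j < i + l \<longrightarrow> ds ! j)"
    using True decode_constant_iff[of i l ds c] by simp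
  show ?thesis
  proof (cases "\<forall>j. i \<le> j \<and> j < i + Suc l \<longrightarrow> decode c ds ! j = b")
    case all: True
    then have last: "decode c ds ! (i + l) = b"
      by simp
    have "(i, Suc l) \<in> runs b (decode c ds) \<longleftrightarrow> (i = 0 \<or> decode c ds ! (i - 1) \<noteq> b)
        \<and> (i + l = length ds \<or> decode c ds ! Suc (i + l) \<noteq> b)"
      unfolding runs_def using True all by simp
    also have "\<dots> \<longleftrightarrow> (i = 0 \<or> \<not> ds ! (i - 1)) \<and> (i + l = length ds \<or> \<not> ds ! (i + l))"
      using left right last by blast
    also have "\<dots> \<longleftrightarrow> (i, l) \<in> runs True ds"
      unfolding runs_def using True all const by simp
    finally show ?thesis
      using True by blast
  next
    case False
    then have "(i, Suc l) \<notin> runs b (decode c ds)"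
      unfolding runs_def by blast
    moreover have "(i, l) \<notin> runs True ds"
      using False const unfolding runs_def by blast
    ultimately show ?thesis
      by blast
  qed
next
  case False
  then show ?thesis
    by (auto simp: runs_def)
qed

lemma finite_runs: "finite (runs c xs)"
  by (rule finite_subset[of _ "{..length xs} \<times> {..length xs}"]) (auto simp: runs_def)

lemma num_runs_decode:
  "num_runs True (Suc a) (Suc b) (decode c ds) + num_runs False (Suc a) (Suc b) (decode c ds)
    = num_runs True a b ds"
proof -
  define R where
    "R e = {(i, l) \<in> runs e (decode c ds). Suc a \<le> l \<and> l \<le> Suc b}" for e
  define T where "T = {(i, l) \<in> runs True ds. a \<le> l \<and> l \<le> b}"
  have R_iff: "(i, l) \<in> R e \<longleftrightarrow> (\<exists>l'. l = Suc l' \<and> e = decode c ds ! i \<and> (i, l') \<in> T)" for i l e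
    by (cases l) (auto simp: R_def T_def runs_decode_iff)
  have fin: "finite (R e)" for e
    by (rule finite_subset[OF _ finite_runs[of e "decode c ds"]]) (auto simp: R_def)
  have disj: "R True \<inter> R False = {}"
    by (auto simp: R_iff)
  have union: "R True \<union> R False = (\<lambda>(i, l). (i, Suc l)) ` T"
    by (force simp: R_iff)
  have "card (R True) + card (R False) = card (R True \<union> R False)"
    using fin disj by (simp add: card_Un_disjoint)
  also have "\<dots> = card T"
    unfolding union by (rule card_image) (auto simp: inj_on_def)
  finally show ?thesis
    by (simp add: R_def T_def num_runs_def)
qed

lemma s_num_eq_w_num: "s_num (Suc a) (Suc b) n m = 2 * w_num a b (n - 1) m"
proof (cases "n \<ge> 1")
  case True
  define n' where "n' = nat (n - 1)"
  then have n: "nat n = Suc n'"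
    using True by linarith
  let ?W = "{ds \<in> strings n'. int (num_runs True a b ds) = m}"
  let ?S = "{xs \<in> strings (Suc n'). int (num_runs True (Suc a) (Suc b) xs
    + num_runs False (Suc a) (Suc b) xs) = m}"
  have "bij_betw (\<lambda>(c, ds). decode c ds) (UNIV \<times> ?W) ?S"
  proof (rule bij_betw_subset[OF bij_betw_decode[of n']])
    have "?S = {xs \<in> (\<lambda>(c, ds). decode c ds) ` (UNIV \<times> strings n').
        int (num_runs True (Suc a) (Suc b) xs + num_runs False (Suc a) (Suc b) xs) = m}"
      using bij_betw_imp_surj_on[OF bij_betw_decode[of n']] by simp
    also have "\<dots> = (\<lambda>(c, ds). decode c ds) ` (UNIV \<times> ?W)"
      by (auto simp: num_runs_decode simp flip: of_nat_add)
    finally show "(\<lambda>(c, ds). decode c ds) ` (UNIV \<times> ?W) = ?S"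
      by simp
  qed auto
  then have "card ?S = card ((UNIV :: bool set) \<times> ?W)"
    by (rule bij_betw_same_card[symmetric])
  also have "\<dots> = 2 * card ?W"
    by (simp add: card_cartesian_product)
  finally show ?thesis
    using True by (simp add: s_num_def w_num_def n n'_def[symmetric])
qed (auto simp: s_num_def w_num_def)

theorem theorem5p1:
  fixes k K :: nat
  assumes "1 \<le> k" and "k \<le> K"
  shows "S_series k K = 2 * fls_X * W_series (k - 1) (K - 1)"
proof (intro fls_eqI poly_eqI)
  fix n m
  let ?W = "W_series (k - 1) (K - 1)"
  have "2 * fls_X * ?W = fls_X * ?W + fls_X * ?W"
    by (simp only: mult_2 distrib_right)
  then have "fls_nth (2 * fls_X * ?W) n = fls_nth ?W (n - 1) + fls_nth ?W (n - 1)"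
    by (simp only: fls_plus_nth fls_X_times_conv_shift fls_shift_nth) simp
  then have "coeff (fls_nth (2 * fls_X * ?W) n) m
      = 2 * int (w_num (k - 1) (K - 1) (n - 1) (int m))"
    by (simp only: coeff_add coeff_W_series)
  moreover have "s_num k K n (int m) = 2 * w_num (k - 1) (K - 1) (n - 1) (int m)"
    using s_num_eq_w_num[of "k - 1" "K - 1" n "int m"] assms by simp
  ultimately show "coeff (fls_nth (S_series k K) n) m = coeff (fls_nth (2 * fls_X * ?W) n) m"
    by (simp add: coeff_S_series)
qed

end
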